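(* Suppose that for every $t_0\in T$ the largest singular value $\sigma_{\max}(t)$ of $W(t)$ is simple for all $t\ge t_0$, and that $\|f(t,x)\|\le l(t)\|x\|$ for all $x\in\Omega_1$, $t\ge t_0$. Let $$\chi(t_0)=\limsup_{t\to\infty}\,(t-t_0)^{-1}\Big(\int_{t_0}^t k(s)l(s)\,ds+\ln\|W(t)\|\Big),\qquad \theta(t,\tau)=\exp\Big(\int_\tau^t\big(p(s)+k(s)l(s)\big)ds\Big).$$ Assume that $\chi(t_0)<0$ for all $t_0\in T$; that $\theta(t,\tau)\le\hat D_\varepsilon e^{-\rho(t-\tau)}$ for all $t\ge\tau\ge t_0$, where $-\rho=\chi+\varepsilon$, $\rho>0$, $\varepsilon>0$ is an arbitrarily small value, and $\hat D_\varepsilon>0$ is a constant independent of $t_0$; that $\hat F$ and $\|x_0\|$ are sufficiently small; and that $\sup_{t\ge t_0}k(t)=\hat k<\infty$ for all $t_0\in T$. Then the solutions $x(t,x_0)$ of $\dot x=A(t)x+f(t,x)+F(t)$, $x(t_0,x_0)=x_0$, are bounded in norm and $$\limsup_{t\to\infty}\|x(t,x_0)\|\le\hat D_\varepsilon\hat F\hat k/\rho .$$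
   Context: $\|\cdot\|$ is the Euclidean norm on $\mathbb{R}^n$ and the induced spectral norm on matrices. $T=[\varsigma,\infty)$ with $\varsigma\in\mathbb{R}$. Consider $\dot x=A(t)x+f(t,x)+F(t)$, $x\in\mathbb{R}^n$, $t\ge t_0\in T$, where $A(t)\in\mathbb{R}^{n\times n}$, $f(t,x)\in\mathbb{R}^n$ and $F(t)\in\mathbb{R}^n$ are continuous, $f(t,0)=0$, and $F(t)=\hat F\phi(t)$ with $\|\phi(t)\|=1$ and a scalar $\hat F\ge0$. The solution $x(t,x_0)$ with $x(t_0,x_0)=x_0$ is assumed to be uniquely defined for all $t\ge t_0$ whenever $x_0$ lies in a fixed neighborhood of $0$. For given $t_0$, $W(t)$ is a fundamental solution matrix of $\dot x=A(t)x$ normalized so that $\|W(t_0)\|=1$ (so $W$, $p$, $k$ may depend on $t_0$); $p(t)=\frac{d}{dt}\ln\|W(t)\|$ and $k(t)=\|W(t)\|\,\|W^{-1}(t)\|$. $\Omega_1\subset\mathbb{R}^n$ is a bounded neighborhood of $0$, and $l$ is a continuous function with $0<l(t)\le\hat l<\infty$. *)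

theory Defs
  imports "HOL-Analysis.Analysis"
begin

(* The norm of the type real^'n^'n is the Frobenius norm, so the spectral norm has to be
   introduced as the operator norm. *)
definition spectral_norm :: "real ^ 'n ^ 'n \<Rightarrow> real" where
  "spectral_norm M = onorm (\<lambda>v. M *v v)"

definition gram_eigenspace :: "real ^ 'n ^ 'n \<Rightarrow> real \<Rightarrow> (real ^ 'n) set" where
  "gram_eigenspace M \<sigma> = {v. (transpose M ** M) *v v = \<sigma>\<^sup>2 *\<^sub>R v}"

definition singular_value :: "real ^ 'n ^ 'n \<Rightarrow> real \<Rightarrow> bool" where
  "singular_value M \<sigma> \<longleftrightarrow> 0 \<le> \<sigma> \<and> (\<exists>v \<in> gram_eigenspace M \<sigma>. v \<noteq> 0)"

definition sigma_max :: "real ^ 'n ^ 'n \<Rightarrow> real" where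
  "sigma_max M = (GREATEST \<sigma>. singular_value M \<sigma>)"

(* The Gram matrix is symmetric, so the multiplicity of an eigenvalue is the dimension of
   its eigenspace. *)
definition simple_singular_value :: "real ^ 'n ^ 'n \<Rightarrow> real \<Rightarrow> bool" where
  "simple_singular_value M \<sigma> \<longleftrightarrow> singular_value M \<sigma> \<and> dim (gram_eigenspace M \<sigma>) = 1"

definition fundamental_matrix ::
    "(real \<Rightarrow> real ^ 'n ^ 'n) \<Rightarrow> real \<Rightarrow> (real \<Rightarrow> real ^ 'n ^ 'n) \<Rightarrow> bool" where
  "fundamental_matrix A t0 W \<longleftrightarrow>
     (\<forall>t\<ge>t0. (W has_vector_derivative A t ** W t) (at t within {t0..}) \<and> invertible (W t))"

(* The derivative is one-sided at t = t0, where W need not extend to the left. *)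
definition log_growth :: "real \<Rightarrow> (real \<Rightarrow> real ^ 'n ^ 'n) \<Rightarrow> real \<Rightarrow> real" where
  "log_growth t0 W t =
     vector_derivative (\<lambda>s. ln (spectral_norm (W s))) (at t within {t0..})"

definition cond_number :: "(real \<Rightarrow> real ^ 'n ^ 'n) \<Rightarrow> real \<Rightarrow> real" where
  "cond_number W t = spectral_norm (W t) * spectral_norm (matrix_inv (W t))"

(* Extended real, since the upper limit may be minus infinity. *)
definition chi :: "real \<Rightarrow> (real \<Rightarrow> real ^ 'n ^ 'n) \<Rightarrow> (real \<Rightarrow> real) \<Rightarrow> ereal" where
  "chi t0 W l = Limsup at_top (\<lambda>t. ereal (inverse (t - t0) *
     (integral {t0..t} (\<lambda>s. cond_number W s * l s) + ln (spectral_norm (W t)))))"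

definition theta ::
    "real \<Rightarrow> (real \<Rightarrow> real ^ 'n ^ 'n) \<Rightarrow> (real \<Rightarrow> real) \<Rightarrow> real \<Rightarrow> real \<Rightarrow> real" where
  "theta t0 W l t \<tau> =
     exp (integral {\<tau>..t} (\<lambda>s. log_growth t0 W s + cond_number W s * l s))"

definition solves_ivp ::
    "(real \<Rightarrow> real ^ 'n ^ 'n) \<Rightarrow> (real \<Rightarrow> real ^ 'n \<Rightarrow> real ^ 'n) \<Rightarrow> (real \<Rightarrow> real ^ 'n) \<Rightarrow>
     real \<Rightarrow> real ^ 'n \<Rightarrow> (real \<Rightarrow> real ^ 'n) \<Rightarrow> bool" where
  "solves_ivp A f F t0 x0 x \<longleftrightarrow> x t0 = x0 \<and>
     (\<forall>t\<ge>t0. (x has_vector_derivative A t *v x t + f t (x t) + F t) (at t within {t0..}))"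

definition uniquely_solvable ::
    "(real \<Rightarrow> real ^ 'n ^ 'n) \<Rightarrow> (real \<Rightarrow> real ^ 'n \<Rightarrow> real ^ 'n) \<Rightarrow> (real \<Rightarrow> real ^ 'n) \<Rightarrow>
     real \<Rightarrow> (real ^ 'n) set \<Rightarrow> bool" where
  "uniquely_solvable A f F t0 U \<longleftrightarrow> (\<forall>x0\<in>U.
     (\<exists>x. solves_ivp A f F t0 x0 x) \<and>
     (\<forall>x y. solves_ivp A f F t0 x0 x \<and> solves_ivp A f F t0 x0 y \<longrightarrow> (\<forall>t\<ge>t0. x t = y t)))"

end

theory Submission imports Defs begin

text \<open>
  Let \<open>W\<close> be the fundamental matrix based at \<open>t0\<close>, \<open>k\<close> its condition number and
  \<open>K t = \<integral> k l\<close> the integral from \<open>t0\<close> to \<open>t\<close>. Simplicity of the largest singular value makes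
  \<open>\<parallel>W t\<parallel>\<close> differentiable in \<open>t\<close>: the unit vector at which the norm is attained is unique up to sign,
  so Danskin's theorem applies (\<open>ln_spectral_norm_differentiable\<close>). Hence the integral in the
  definition of \<open>theta\<close> can be evaluated, and
  \<open>theta t \<tau> = \<parallel>W t\<parallel> / \<parallel>W \<tau>\<parallel> exp (K t - K \<tau>)\<close> (\<open>theta_eq_spectral_norm_quotient\<close>).

  For a solution \<open>x\<close> put \<open>c = W\<^sup>-\<^sup>1 x\<close>. Variation of constants gives \<open>c' = W\<^sup>-\<^sup>1 (f + F)\<close>, and as
  long as \<open>x\<close> stays where \<open>\<parallel>f\<parallel> \<le> l \<parallel>x\<parallel>\<close>, Gronwall's inequality for \<open>c\<close> bounds
  \<open>\<parallel>x t\<parallel> \<le> \<parallel>W t\<parallel> \<parallel>c t\<parallel>\<close> in terms of \<open>theta\<close>. Inserting the exponential bound on \<open>theta\<close> yields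
  \<open>\<parallel>x t\<parallel> \<le> D m \<parallel>x0\<parallel> e + (D a m / \<rho>) (1 - e)\<close> with \<open>e = exp (- \<rho> (t - t0))\<close>, where \<open>m\<close> is the
  supremum of \<open>k\<close> and \<open>a\<close> is the amplitude of the forcing term \<open>F\<close>
  (\<open>perturbed_solution_bound\<close>).

  If \<open>x0\<close> and \<open>a\<close> are small, this estimate is strictly smaller than the radius of a ball on which the
  bound on \<open>f\<close> is valid. A first-exit argument (\<open>norm_less_by_continuation\<close>) shows that \<open>x\<close> never leaves
  that ball, so the estimate holds for all times, and letting \<open>t\<close> tend to infinity gives the theorem.
\<close>

section \<open>The spectral norm and the largest singular value\<close>

lemma bounded_bilinear_matrix_vector_mult:
  "bounded_bilinear (\<lambda>(M :: real ^ 'n ^ 'm) v. M *v v)"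
  by (simp add: bilinear_conv_bounded_bilinear [symmetric] bilinear_def Real_Vector_Spaces.linear_iff
      matrix_vector_mult_add_rdistrib matrix_vector_right_distrib scaleR_matrix_vector_assoc
      matrix_vector_mult_scaleR)

lemma norm_matrix_vector_le_spectral_norm: "norm (M *v v) \<le> spectral_norm M * norm v"
  unfolding spectral_norm_def by (rule onorm) simp

lemma spectral_norm_nonneg: "0 \<le> spectral_norm M"
  unfolding spectral_norm_def by (rule onorm_pos_le) simp

lemma spectral_norm_pos:
  fixes M :: "real ^ 'n ^ 'n"
  assumes "invertible M"
  shows "0 < spectral_norm M"
proof -
  have "M *v axis undefined 1 \<noteq> 0"
    using assms by (metis axis_eq_0_iff inj_matrix_vector_mult matrix_vector_mult_0_right injD zero_neq_one)
  then show ?thesis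
    unfolding spectral_norm_def by (subst onorm_pos_lt) auto
qed

text \<open>
  The unit sphere is compact, so the operator norm is a maximum. The maximising vectors are the
  link between the norm and the singular values below.
\<close>
lemma spectral_norm_attained:
  fixes M :: "real ^ 'n ^ 'n"
  obtains v where "norm v = 1" "norm (M *v v) = spectral_norm M"
proof -
  have "sphere (0 :: real ^ 'n) 1 \<noteq> {}"
    by simp
  moreover have "continuous_on (sphere 0 1) (\<lambda>v. norm (M *v v))"
    by (intro continuous_intros linear_continuous_on) simp
  ultimately obtain v where v: "v \<in> sphere 0 1"
    and max: "\<And>w. w \<in> sphere 0 1 \<Longrightarrow> norm (M *v w) \<le> norm (M *v v)"
    using continuous_attains_sup compact_sphere by metis
  have "norm (M *v w) \<le> norm (M *v v) * norm w" for w
  proof (cases "w = 0")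
    case False
    then have "norm (M *v (w /\<^sub>R norm w)) \<le> norm (M *v v)"
      by (intro max) simp
    then show ?thesis
      using False by (simp add: matrix_vector_mult_scaleR field_simps)
  qed simp
  then have "spectral_norm M \<le> norm (M *v v)"
    unfolding spectral_norm_def by (rule onorm_le)
  moreover have "norm (M *v v) \<le> spectral_norm M"
    using norm_matrix_vector_le_spectral_norm [of M v] v by simp
  ultimately show thesis
    using v by (intro that [of v]) auto
qed

text \<open>
  Pairing \<open>M\<^sup>T w\<close> with itself and moving one factor across the inner product bounds its squared
  norm by \<open>\<parallel>w\<parallel> \<parallel>M\<parallel> \<parallel>M\<^sup>T w\<parallel>\<close>.
\<close>
lemma norm_transpose_mult_le_spectral_norm:
  fixes M :: "real ^ 'n ^ 'n"
  shows "norm (transpose M *v w) \<le> spectral_norm M * norm w"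
proof (cases "transpose M *v w = 0")
  case False
  have "(norm (transpose M *v w))\<^sup>2 = w \<bullet> (M *v (transpose M *v w))"
    by (metis dot_lmul_matrix power2_norm_eq_inner vector_transpose_matrix transpose_transpose)
  also have "\<dots> \<le> norm w * norm (M *v (transpose M *v w))"
    by (rule norm_cauchy_schwarz)
  also have "\<dots> \<le> norm w * (spectral_norm M * norm (transpose M *v w))"
    by (intro mult_left_mono norm_matrix_vector_le_spectral_norm norm_ge_zero)
  finally show ?thesis
    using False by (simp add: power2_eq_square mult_ac)
qed (simp add: spectral_norm_nonneg)

lemma inner_gram: "v \<bullet> ((transpose M ** M) *v w) = (M *v v) \<bullet> (M *v w)"
  for M :: "real ^ 'n ^ 'n"
  by (metis dot_lmul_matrix inner_commute matrix_vector_mul_assoc vector_transpose_matrix)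

text \<open>
  Write \<open>\<sigma> = \<parallel>M\<parallel>\<close> and \<open>g = M\<^sup>T M v\<close>. Then \<open>\<parallel>g\<parallel> \<le> \<sigma>\<^sup>2\<close> while \<open>v \<bullet> g = \<parallel>M v\<parallel>\<^sup>2 = \<sigma>\<^sup>2\<close>. This is the
  equality case of the Cauchy-Schwarz inequality, and it forces \<open>g = \<sigma>\<^sup>2 v\<close>: expanding
  \<open>\<parallel>g - \<sigma>\<^sup>2 v\<parallel>\<^sup>2\<close> leaves \<open>\<parallel>g\<parallel>\<^sup>2 - \<sigma>\<^sup>4 \<le> 0\<close>.
\<close>
lemma maximiser_in_gram_eigenspace:
  fixes M :: "real ^ 'n ^ 'n"
  assumes "norm v = 1" "norm (M *v v) = spectral_norm M"
  shows "v \<in> gram_eigenspace M (spectral_norm M)"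
proof -
  let ?\<sigma> = "spectral_norm M" and ?g = "(transpose M ** M) *v v"
  have "norm ?g \<le> ?\<sigma> * ?\<sigma>"
    using norm_transpose_mult_le_spectral_norm [of M "M *v v"] assms
    by (simp add: matrix_vector_mul_assoc)
  then have g: "(norm ?g)\<^sup>2 \<le> (?\<sigma>\<^sup>2)\<^sup>2"
    by (intro power_mono) (auto simp: power2_eq_square)
  have vg: "v \<bullet> ?g = ?\<sigma>\<^sup>2"
    using assms by (simp add: inner_gram power2_norm_eq_inner [symmetric])
  have "(norm (?g - ?\<sigma>\<^sup>2 *\<^sub>R v))\<^sup>2 = (norm ?g)\<^sup>2 - 2 * ?\<sigma>\<^sup>2 * (v \<bullet> ?g) + (?\<sigma>\<^sup>2)\<^sup>2 * (norm v)\<^sup>2"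
    unfolding power2_norm_eq_inner
    by (simp add: inner_diff_left inner_diff_right inner_commute power2_eq_square algebra_simps)
  also have "\<dots> = (norm ?g)\<^sup>2 - (?\<sigma>\<^sup>2)\<^sup>2"
    using assms unfolding vg by (simp add: power2_eq_square)
  also have "\<dots> \<le> 0"
    using g by simp
  finally show ?thesis
    by (simp add: gram_eigenspace_def)
qed

lemma singular_value_le_spectral_norm:
  fixes M :: "real ^ 'n ^ 'n"
  assumes "singular_value M \<sigma>"
  shows "\<sigma> \<le> spectral_norm M"
proof -
  obtain v where v: "v \<noteq> 0" "(transpose M ** M) *v v = \<sigma>\<^sup>2 *\<^sub>R v" and "0 \<le> \<sigma>"
    using assms by (auto simp: singular_value_def gram_eigenspace_def)
  have "(norm (M *v v))\<^sup>2 = v \<bullet> ((transpose M ** M) *v v)"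
    by (simp add: inner_gram power2_norm_eq_inner)
  also have "\<dots> = (\<sigma> * norm v)\<^sup>2"
    unfolding v by (simp add: power_mult_distrib power2_norm_eq_inner)
  finally have "norm (M *v v) = \<sigma> * norm v"
    using \<open>0 \<le> \<sigma>\<close> by (simp add: power2_eq_iff_nonneg)
  then show ?thesis
    using norm_matrix_vector_le_spectral_norm [of M v] v by simp
qed

text \<open>
  A maximiser of \<open>\<parallel>M v\<parallel>\<close> exhibits the spectral norm as a singular value, and no singular value
  exceeds it.
\<close>
lemma sigma_max_eq_spectral_norm: "sigma_max M = spectral_norm M"
proof -
  obtain v where "norm v = 1" "norm (M *v v) = spectral_norm M"
    by (rule spectral_norm_attained)
  then have "singular_value M (spectral_norm M)"
    using maximiser_in_gram_eigenspace [of v M]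
    by (auto simp: singular_value_def spectral_norm_nonneg intro!: bexI [of _ v])
  then show ?thesis
    unfolding sigma_max_def by (intro Greatest_equality singular_value_le_spectral_norm)
qed

text \<open>
  Simplicity of the largest singular value enters here: the maximisers lie in a one-dimensional
  eigenspace, so the unit ones are unique up to sign.
\<close>
lemma maximisers_antipodal:
  fixes M :: "real ^ 'n ^ 'n"
  assumes "simple_singular_value M (sigma_max M)"
    and "norm v = 1" "norm (M *v v) = spectral_norm M"
    and "norm w = 1" "norm (M *v w) = spectral_norm M"
  shows "w = v \<or> w = - v"
proof -
  let ?E = "gram_eigenspace M (spectral_norm M)"
  have "subspace ?E"
    by (auto simp: subspace_def gram_eigenspace_def matrix_vector_right_distrib
        scaleR_right_distrib matrix_vector_mult_scaleR)
  moreover have "v \<in> ?E" "w \<in> ?E"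
    using assms by (auto intro: maximiser_in_gram_eigenspace)
  moreover have "dim ?E = 1"
    using assms(1) by (simp add: simple_singular_value_def sigma_max_eq_spectral_norm)
  moreover have "v \<noteq> 0"
    using assms(2) by auto
  ultimately have "span {v} = ?E"
    by (intro subspace_dim_equal) (auto simp: dim_singleton span_minimal)
  then obtain c where c: "w = c *\<^sub>R v"
    using \<open>w \<in> ?E\<close> by (auto simp: span_singleton)
  then have "\<bar>c\<bar> = 1"
    using assms by simp
  then show ?thesis
    using c by (auto simp: abs_if split: if_splits)
qed

section \<open>Differentiability of the spectral norm\<close>

text \<open>
  Danskin's theorem for a maximum \<open>m s = max\<^sub>v h s v\<close> over a compact set. If all maximisers at
  \<open>t\<close> have the same partial derivative \<open>d\<close>, then \<open>m\<close> is differentiable at \<open>t\<close>. A maximiser at \<open>t\<close>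
  bounds the increment of \<open>m\<close> from below. A maximiser at a nearby time \<open>s\<close> bounds it from above,
  and it is nearly a maximiser at \<open>t\<close>, so by compactness its partial derivative is close to \<open>d\<close>.
\<close>
lemma danskin_has_real_derivative:
  fixes h :: "real \<Rightarrow> 'a :: metric_space \<Rightarrow> real"
  assumes "compact S" "t \<in> I"
    and h_cont: "continuous_on S (h t)" and D_cont: "continuous_on S D"
    and le: "\<And>s v. s \<in> I \<Longrightarrow> v \<in> S \<Longrightarrow> h s v \<le> m s"
    and att: "\<And>s. s \<in> I \<Longrightarrow> \<exists>v\<in>S. h s v = m s"
    and unif: "\<And>e. 0 < e \<Longrightarrow> \<exists>r>0. \<forall>s\<in>I. \<bar>s - t\<bar> < r \<longrightarrow>
        (\<forall>v\<in>S. \<bar>h s v - h t v - (s - t) * D v\<bar> \<le> e * \<bar>s - t\<bar>)"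
    and uniq: "\<And>v. v \<in> S \<Longrightarrow> h t v = m t \<Longrightarrow> D v = d"
  shows "(m has_real_derivative d) (at t within I)"
proof -
  \<comment> \<open>A near-maximiser at time \<open>t\<close> has partial derivative close to \<open>d\<close>.\<close>
  have near: "\<exists>\<eta>>0. \<forall>v\<in>S. m t - \<eta> < h t v \<longrightarrow> \<bar>D v - d\<bar> < e" if "0 < e" for e
  proof -
    let ?B = "{v \<in> S. e \<le> \<bar>D v - d\<bar>}"
    have B_compact: "compact ?B"
    proof -
      have "continuous_on S (\<lambda>v. \<bar>D v - d\<bar>)"
        by (intro continuous_on_rabs continuous_on_diff D_cont continuous_on_const)
      from continuous_closedin_preimage [OF this, of "{e..}"]
      have "closedin (top_of_set S) (S \<inter> (\<lambda>v. \<bar>D v - d\<bar>) -` {e..})"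
        by simp
      also have "S \<inter> (\<lambda>v. \<bar>D v - d\<bar>) -` {e..} = ?B"
        by auto
      finally show ?thesis
        by (rule closedin_compact [OF \<open>compact S\<close>])
    qed
    show ?thesis
    proof (cases "?B = {}")
      case True
      then have "\<forall>v\<in>S. \<bar>D v - d\<bar> < e"
        by fastforce
      then show ?thesis
        by (intro exI [of _ 1]) simp
    next
      case False
      moreover have "continuous_on ?B (h t)"
        using h_cont by (rule continuous_on_subset) auto
      ultimately obtain b where b: "b \<in> ?B" "\<forall>v\<in>?B. h t v \<le> h t b"
        by (rule bexE [OF continuous_attains_sup [OF B_compact]])
      have "h t b \<noteq> m t"
        using uniq [of b] b(1) \<open>0 < e\<close> by auto
      then have "h t b < m t"
        using le [OF \<open>t \<in> I\<close>, of b] b(1) by simp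
      moreover have "\<bar>D v - d\<bar> < e" if "v \<in> S" "h t b < h t v" for v
        using b(2) that by (cases "e \<le> \<bar>D v - d\<bar>") auto
      ultimately show ?thesis
        by (intro exI [of _ "m t - h t b"]) simp
    qed
  qed
  obtain B where B: "0 < B" "\<And>v. v \<in> S \<Longrightarrow> \<bar>D v\<bar> \<le> B"
    using compact_imp_bounded [OF compact_continuous_image [OF D_cont \<open>compact S\<close>]]
    by (auto simp: bounded_pos)
  have "\<exists>r>0. \<forall>s\<in>I. \<bar>s - t\<bar> < r \<longrightarrow> \<bar>m s - m t - d * (s - t)\<bar> \<le> e * \<bar>s - t\<bar>"
    if "0 < e" for e
  proof -
    obtain \<eta> where \<eta>: "0 < \<eta>" "\<And>v. v \<in> S \<Longrightarrow> m t - \<eta> < h t v \<Longrightarrow> \<bar>D v - d\<bar> < e / 2"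
      using near [of "e / 2"] \<open>0 < e\<close> by auto
    obtain r1 where r1: "0 < r1" "\<And>s v. s \<in> I \<Longrightarrow> \<bar>s - t\<bar> < r1 \<Longrightarrow> v \<in> S \<Longrightarrow>
        \<bar>h s v - h t v - (s - t) * D v\<bar> \<le> e / 2 * \<bar>s - t\<bar>"
      using unif [of "e / 2"] \<open>0 < e\<close> by auto
    obtain r2 where r2: "0 < r2" "\<And>s v. s \<in> I \<Longrightarrow> \<bar>s - t\<bar> < r2 \<Longrightarrow> v \<in> S \<Longrightarrow>
        \<bar>h s v - h t v - (s - t) * D v\<bar> \<le> 1 * \<bar>s - t\<bar>"
      using unif [of 1] by auto
    \<comment> \<open>The last bound makes a maximiser at \<open>s\<close> fall short of \<open>m t\<close> at time \<open>t\<close> by less than \<open>\<eta>\<close>.\<close>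
    define r where "r = min (min r1 r2) (\<eta> / (2 * (B + 1)))"
    have "\<bar>m s - m t - d * (s - t)\<bar> \<le> e * \<bar>s - t\<bar>" if s: "s \<in> I" "\<bar>s - t\<bar> < r" for s
    proof -
      obtain vt where vt: "vt \<in> S" "h t vt = m t"
        using att \<open>t \<in> I\<close> by blast
      obtain vs where vs: "vs \<in> S" "h s vs = m s"
        using att \<open>s \<in> I\<close> by blast
      have lip: "\<bar>h s v - h t v\<bar> \<le> (B + 1) * \<bar>s - t\<bar>" if "v \<in> S" for v
      proof -
        have "\<bar>(s - t) * D v\<bar> \<le> B * \<bar>s - t\<bar>"
          unfolding abs_mult mult.commute [of "\<bar>s - t\<bar>"]
          using B(2) [OF that] by (intro mult_right_mono) auto
        moreover have "\<bar>h s v - h t v - (s - t) * D v\<bar> \<le> 1 * \<bar>s - t\<bar>"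
          using s by (intro r2(2) that) (auto simp: r_def)
        ultimately show ?thesis
          unfolding distrib_right by linarith
      qed
      have "2 * ((B + 1) * \<bar>s - t\<bar>) < \<eta>"
        using s(2) B(1) by (simp add: r_def field_simps)
      moreover have "m t - (B + 1) * \<bar>s - t\<bar> \<le> h s vt"
        using lip [OF vt(1)] vt(2) by linarith
      moreover have "h s vt \<le> m s"
        using le s vt by blast
      moreover have "m s - (B + 1) * \<bar>s - t\<bar> \<le> h t vs"
        using lip [OF vs(1)] vs(2) by linarith
      ultimately have "\<bar>D vs - d\<bar> < e / 2"
        by (intro \<eta>(2) vs) linarith
      then have "\<bar>(s - t) * (D vs - d)\<bar> \<le> e / 2 * \<bar>s - t\<bar>"
        unfolding abs_mult mult.commute [of "\<bar>s - t\<bar>"] by (intro mult_right_mono) auto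
      moreover have "\<bar>h s vs - h t vs - (s - t) * D vs\<bar> \<le> e / 2 * \<bar>s - t\<bar>"
        using s by (intro r1(2) vs) (auto simp: r_def)
      moreover have "h t vs \<le> m t"
        using le vs \<open>t \<in> I\<close> by blast
      moreover have "(s - t) * (D vs - d) = (s - t) * D vs - d * (s - t)"
        by (simp add: algebra_simps)
      ultimately have "m s - m t - d * (s - t) \<le> e * \<bar>s - t\<bar>"
        using vs(2) by linarith
      moreover have "\<bar>h s vt - h t vt - (s - t) * D vt\<bar> \<le> e / 2 * \<bar>s - t\<bar>"
        using s by (intro r1(2) vt) (auto simp: r_def)
      then have "- (e * \<bar>s - t\<bar>) \<le> m s - m t - d * (s - t)"
        unfolding uniq [OF vt] vt(2) mult.commute [of d]
        using \<open>h s vt \<le> m s\<close> \<open>0 < e\<close> mult_nonneg_nonneg [of e "\<bar>s - t\<bar>"] by linarith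
      ultimately show ?thesis
        by linarith
    qed
    moreover have "0 < r"
      using r1 r2 \<eta> B by (simp add: r_def)
    ultimately show ?thesis
      by blast
  qed
  then show ?thesis
    unfolding has_field_derivative_def has_derivative_within_alt
    by (auto simp: bounded_linear_mult_right)
qed

lemma bounded_bilinear_gram:
  "bounded_bilinear (\<lambda>(M :: real ^ 'n ^ 'n) N. transpose M ** N)"
  by (simp add: bilinear_conv_bounded_bilinear [symmetric] bilinear_def Real_Vector_Spaces.linear_iff
      vec_eq_iff matrix_matrix_mult_def transpose_def sum.distrib algebra_simps sum_distrib_left)

text \<open>
  The square \<open>\<parallel>W s\<parallel>\<^sup>2\<close> is the maximum over the unit sphere of the quadratic form \<open>v \<bullet> G s v\<close> of
  the Gram matrix \<open>G s\<close>, which is differentiable in \<open>s\<close> uniformly in \<open>v\<close>. A quadratic form takes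
  the same value at \<open>v\<close> and \<open>-v\<close>, so uniqueness of the maximiser up to sign is enough for
  Danskin's theorem.
\<close>
lemma ln_spectral_norm_differentiable:
  fixes W :: "real \<Rightarrow> real ^ 'n ^ 'n"
  assumes W': "(W has_vector_derivative W') (at t within I)" and "t \<in> I"
    and inv: "invertible (W t)"
    and simple: "simple_singular_value (W t) (sigma_max (W t))"
  obtains p where "((\<lambda>s. ln (spectral_norm (W s))) has_real_derivative p) (at t within I)"
proof -
  define G where "G s = transpose (W s) ** W s" for s
  obtain G' where G': "(G has_vector_derivative G') (at t within I)"
    unfolding G_def using bounded_bilinear.has_vector_derivative [OF bounded_bilinear_gram W' W'] by blast
  obtain K where K: "0 < K" "\<And>(M :: real ^ 'n ^ 'n) v. norm (M *v v) \<le> norm M * norm v * K"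
    using bounded_bilinear.pos_bounded [OF bounded_bilinear_matrix_vector_mult] by blast
  have h: "v \<bullet> (G s *v v) = (norm (W s *v v))\<^sup>2" for s v
    by (simp add: G_def inner_gram power2_norm_eq_inner)
  obtain vt where vt: "norm vt = 1" "norm (W t *v vt) = spectral_norm (W t)"
    by (rule spectral_norm_attained)
  have "((\<lambda>s. (spectral_norm (W s))\<^sup>2) has_real_derivative vt \<bullet> (G' *v vt)) (at t within I)"
  proof (rule danskin_has_real_derivative [of "sphere 0 1" _ _ "\<lambda>s v. v \<bullet> (G s *v v)"
        "\<lambda>v. v \<bullet> (G' *v v)"])
    show "continuous_on (sphere 0 1) (\<lambda>v. v \<bullet> (G t *v v))"
      "continuous_on (sphere 0 1) (\<lambda>v. v \<bullet> (G' *v v))"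
      by (intro continuous_intros linear_continuous_on; simp)+
  next
    fix s v assume "v \<in> sphere (0 :: real ^ 'n) 1"
    then show "v \<bullet> (G s *v v) \<le> (spectral_norm (W s))\<^sup>2"
      unfolding h using norm_matrix_vector_le_spectral_norm [of "W s" v] by (simp add: power_mono)
  next
    fix s
    obtain v where "norm v = 1" "norm (W s *v v) = spectral_norm (W s)"
      by (rule spectral_norm_attained)
    then show "\<exists>v\<in>sphere 0 1. v \<bullet> (G s *v v) = (spectral_norm (W s))\<^sup>2"
      by (intro bexI [of _ v]) (auto simp: h)
  next
    fix e :: real assume "0 < e"
    then obtain r where r: "0 < r" "\<And>s. s \<in> I \<Longrightarrow> \<bar>s - t\<bar> < r \<Longrightarrow>
        norm (G s - G t - (s - t) *\<^sub>R G') \<le> e / K * \<bar>s - t\<bar>"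
      using G' K(1) unfolding has_vector_derivative_def has_derivative_within_alt real_norm_def
      by (metis divide_pos_pos)
    have "\<bar>v \<bullet> (G s *v v) - v \<bullet> (G t *v v) - (s - t) * (v \<bullet> (G' *v v))\<bar> \<le> e * \<bar>s - t\<bar>"
      if "s \<in> I" "\<bar>s - t\<bar> < r" "norm v = 1" for s v
    proof -
      have "v \<bullet> (G s *v v) - v \<bullet> (G t *v v) - (s - t) * (v \<bullet> (G' *v v))
          = v \<bullet> ((G s - G t - (s - t) *\<^sub>R G') *v v)"
        by (simp add: matrix_vector_mult_diff_rdistrib inner_diff_right
            scaleR_matrix_vector_assoc [symmetric])
      also have "\<bar>\<dots>\<bar> \<le> norm ((G s - G t - (s - t) *\<^sub>R G') *v v)"
        using Cauchy_Schwarz_ineq2 [of v "(G s - G t - (s - t) *\<^sub>R G') *v v"] that(3) by simp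
      also have "\<dots> \<le> norm (G s - G t - (s - t) *\<^sub>R G') * K"
        using K(2) [of "G s - G t - (s - t) *\<^sub>R G'" v] that(3) by simp
      also have "\<dots> \<le> e / K * \<bar>s - t\<bar> * K"
        using r(2) that K(1) by (intro mult_right_mono) auto
      finally show ?thesis
        using K(1) by simp
    qed
    then show "\<exists>r>0. \<forall>s\<in>I. \<bar>s - t\<bar> < r \<longrightarrow> (\<forall>v\<in>sphere 0 1.
        \<bar>v \<bullet> (G s *v v) - v \<bullet> (G t *v v) - (s - t) * (v \<bullet> (G' *v v))\<bar> \<le> e * \<bar>s - t\<bar>)"
      using r(1) by (intro exI [of _ r]) auto
  next
    fix v assume "v \<in> sphere (0 :: real ^ 'n) 1" "v \<bullet> (G t *v v) = (spectral_norm (W t))\<^sup>2"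
    then have "norm v = 1" "norm (W t *v v) = spectral_norm (W t)"
      by (auto simp: h power2_eq_iff_nonneg spectral_norm_nonneg)
    then have "v = vt \<or> v = - vt"
      using maximisers_antipodal [OF simple vt] by blast
    then show "v \<bullet> (G' *v v) = vt \<bullet> (G' *v vt)"
      by (auto simp: linear_neg [OF matrix_vector_mul_linear])
  qed (use \<open>t \<in> I\<close> in auto)
  \<comment> \<open>Pass from the square to the logarithm of the norm itself.\<close>
  from DERIV_chain2 [OF DERIV_ln this]
  have "((\<lambda>s. 1 / 2 * ln ((spectral_norm (W s))\<^sup>2)) has_real_derivative
      1 / 2 * (inverse ((spectral_norm (W t))\<^sup>2) * (vt \<bullet> (G' *v vt)))) (at t within I)"
    using spectral_norm_pos [OF inv] by (intro DERIV_cmult) auto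
  moreover have "1 / 2 * ln ((spectral_norm (W s))\<^sup>2) = ln (spectral_norm (W s))" for s
    using spectral_norm_nonneg [of "W s"]
    by (cases "spectral_norm (W s) = 0") (auto simp: ln_realpow)
  ultimately show thesis
    using that by simp
qed

section \<open>Continuity of the norm and of the inverse\<close>

lemma continuous_on_spectral_norm:
  fixes W :: "'a :: topological_space \<Rightarrow> real ^ 'n ^ 'n"
  assumes "continuous_on S W"
  shows "continuous_on S (\<lambda>s. spectral_norm (W s))"
proof -
  obtain K where K: "0 < K" "\<And>(M :: real ^ 'n ^ 'n) v. norm (M *v v) \<le> norm M * norm v * K"
    using bounded_bilinear.pos_bounded [OF bounded_bilinear_matrix_vector_mult] by blast
  have le: "spectral_norm M \<le> K * norm (M - N) + spectral_norm N" for M N :: "real ^ 'n ^ 'n"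
    unfolding spectral_norm_def [of M]
  proof (rule onorm_le)
    fix v
    have "M *v v = (M - N) *v v + N *v v"
      by (simp add: matrix_vector_mult_diff_rdistrib)
    also have "norm \<dots> \<le> norm ((M - N) *v v) + norm (N *v v)"
      by (rule norm_triangle_ineq)
    also have "\<dots> \<le> norm (M - N) * norm v * K + spectral_norm N * norm v"
      by (intro add_mono K norm_matrix_vector_le_spectral_norm)
    finally show "norm (M *v v) \<le> (K * norm (M - N) + spectral_norm N) * norm v"
      by (simp add: algebra_simps)
  qed
  have "K-lipschitz_on UNIV (spectral_norm :: real ^ 'n ^ 'n \<Rightarrow> real)"
  proof (rule lipschitz_onI)
    fix M N :: "real ^ 'n ^ 'n"
    show "dist (spectral_norm M) (spectral_norm N) \<le> K * dist M N"
      using le [of M N] le [of N M] by (simp add: dist_norm norm_minus_commute abs_le_iff)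
  qed (use K in auto)
  then show ?thesis
    using continuous_on_compose2 [OF lipschitz_on_continuous_on assms] by blast
qed

lemma matrix_mult_matrix_inv:
  assumes "invertible M"
  shows "M ** matrix_inv M = mat 1" "matrix_inv M ** M = mat 1"
  unfolding matrix_inv_def using someI_ex [OF assms [unfolded invertible_def]] by blast+

text \<open>
  By Cramer's rule each entry of the inverse is a quotient of polynomials in the entries.
\<close>
lemma continuous_on_matrix_inv:
  fixes W :: "'a :: topological_space \<Rightarrow> real ^ 'n ^ 'n"
  assumes W: "continuous_on S W" and inv: "\<And>s. s \<in> S \<Longrightarrow> invertible (W s)"
  shows "continuous_on S (\<lambda>s. matrix_inv (W s))"
proof -
  define C where
    "C s i j = det (\<chi> a b. if b = i then (axis j 1 :: real ^ 'n) $ a else W s $ a $ b) / det (W s)"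
    for s i j
  have eq: "matrix_inv (W s) = (\<chi> i j. C s i j)" if "s \<in> S" for s
  proof -
    have "matrix_inv (W s) *v axis j 1 = (\<chi> i. C s i j)" for j
    proof -
      have "W s *v (matrix_inv (W s) *v axis j 1) = axis j 1"
        using inv [OF that] by (simp add: matrix_vector_mul_assoc matrix_mult_matrix_inv)
      moreover have "det (W s) \<noteq> 0"
        using inv [OF that] by (simp add: invertible_det_nz)
      ultimately show ?thesis
        by (simp add: cramer C_def)
    qed
    then show ?thesis
      by (simp add: vec_eq_iff matrix_vector_mult_basis column_def)
  qed
  have "continuous_on S (\<lambda>s. \<chi> i j. C s i j)"
  proof -
    have "continuous_on S (\<lambda>s. W s $ a $ b)" for a b
      by (intro continuous_intros W)
    then have entry: "continuous_on S (\<lambda>s. if P then c else W s $ a $ b)" for P c a b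
      by (cases P) auto
    show ?thesis
      unfolding C_def det_def
      by (intro continuous_intros) (use W entry inv in \<open>auto simp: invertible_det_nz det_def\<close>)
  qed
  then show ?thesis
    using eq by (simp cong: continuous_on_cong)
qed

section \<open>Gronwall's inequality for the norm of a curve\<close>

text \<open>
  A curve with \<open>\<parallel>c'\<parallel> \<le> \<kappa> \<parallel>c\<parallel> + g\<close> grows at most like the solution of the corresponding scalar linear
  equation, for which \<open>exp (- K)\<close> is the integrating factor. The norm of \<open>c\<close> may fail to be
  differentiable where \<open>c\<close> vanishes, so the proof replaces it by a majorant, the primitive \<open>u\<close> of
  \<open>\<kappa> \<parallel>c\<parallel> + g\<close> that starts at \<open>\<parallel>c a\<parallel>\<close>. The conclusion uses the increment of a function \<open>G\<close> in place
  of the integral of \<open>exp (- K) g\<close>, so that an application can insert an explicit majorant.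
\<close>
lemma gronwall_norm_bound:
  fixes c :: "real \<Rightarrow> 'a :: real_normed_vector" and \<kappa> g K G :: "real \<Rightarrow> real"
  assumes "a \<le> b"
    and c_cont: "continuous_on {a..b} c" and \<kappa>_cont: "continuous_on {a..b} \<kappa>"
    and g_cont: "continuous_on {a..b} g"
    and K_cont: "continuous_on {a..b} K" and G_cont: "continuous_on {a..b} G"
    and c': "\<And>s. a < s \<Longrightarrow> s < b \<Longrightarrow> (c has_vector_derivative c' s) (at s)"
    and K': "\<And>s. a < s \<Longrightarrow> s < b \<Longrightarrow> (K has_real_derivative \<kappa> s) (at s)"
    and G': "\<And>s. a < s \<Longrightarrow> s < b \<Longrightarrow> (G has_real_derivative G' s) (at s)"
    and \<kappa>_nonneg: "\<And>s. a < s \<Longrightarrow> s < b \<Longrightarrow> 0 \<le> \<kappa> s"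
    and c'_le: "\<And>s. a < s \<Longrightarrow> s < b \<Longrightarrow> norm (c' s) \<le> \<kappa> s * norm (c s) + g s"
    and G'_ge: "\<And>s. a < s \<Longrightarrow> s < b \<Longrightarrow> exp (- K s) * g s \<le> G' s"
  shows "exp (- K b) * norm (c b) \<le> exp (- K a) * norm (c a) + (G b - G a)"
proof -
  define \<beta> where "\<beta> s = \<kappa> s * norm (c s) + g s" for s
  have \<beta>_cont: "continuous_on {a..b} \<beta>"
    unfolding \<beta>_def by (intro continuous_intros \<kappa>_cont c_cont g_cont)
  define u where "u s = norm (c a) + integral {a..s} \<beta>" for s
  have u'_within: "(u has_real_derivative \<beta> s) (at s within {a..b})" if "s \<in> {a..b}" for s
    unfolding u_def using integral_has_real_derivative [OF \<beta>_cont that]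
    by (auto intro!: derivative_eq_intros)
  have u': "(u has_real_derivative \<beta> s) (at s)" if "a < s" "s < b" for s
    using u'_within [of s] that at_within_Icc_at [of a s b] by simp
  have u_cont: "continuous_on {a..b} u"
    unfolding continuous_on_eq_continuous_within by (blast intro: DERIV_continuous u'_within)
  have c_le_u: "norm (c t) \<le> u t" if "t \<in> {a..b}" for t
  proof (cases "a = t")
    case False
    have "norm (c t - c a) \<le> u t - u a"
    proof (rule differentiable_bound_general [where f' = c' and \<phi>' = \<beta>])
      show "continuous_on {a..t} c" "continuous_on {a..t} u"
        using that by (auto intro: continuous_on_subset [OF c_cont] continuous_on_subset [OF u_cont])
    next
      fix s assume "a < s" "s < t"
      then have s: "a < s" "s < b"
        using that by auto
      show "(c has_vector_derivative c' s) (at s)"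
        by (rule c' [OF s])
      show "(u has_vector_derivative \<beta> s) (at s)"
        unfolding has_real_derivative_iff_has_vector_derivative [symmetric] by (rule u' [OF s])
      show "norm (c' s) \<le> \<beta> s"
        unfolding \<beta>_def by (rule c'_le [OF s])
    qed (use that False in auto)
    then show ?thesis
      using norm_triangle_sub [of "c t" "c a"] by (simp add: u_def)
  qed (simp add: u_def)
  have "exp (- K b) * u b - G b \<le> exp (- K a) * u a - G a"
  proof (rule DERIV_nonpos_imp_decreasing_open [OF \<open>a \<le> b\<close>])
    fix s assume s: "a < s" "s < b"
    have "((\<lambda>s. exp (- K s) * u s - G s) has_real_derivative
        exp (- K s) * (\<beta> s - \<kappa> s * u s) - G' s) (at s)"
      by (rule derivative_eq_intros K' [OF s] u' [OF s] G' [OF s] refl)+ (simp add: algebra_simps)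
    moreover have "\<kappa> s * norm (c s) \<le> \<kappa> s * u s"
      using s by (intro mult_left_mono c_le_u \<kappa>_nonneg) auto
    then have "exp (- K s) * (\<beta> s - \<kappa> s * u s) \<le> exp (- K s) * g s"
      by (intro mult_left_mono) (auto simp: \<beta>_def)
    then have "exp (- K s) * (\<beta> s - \<kappa> s * u s) - G' s \<le> 0"
      using G'_ge [OF s] by linarith
    ultimately show "\<exists>y. ((\<lambda>s. exp (- K s) * u s - G s) has_real_derivative y) (at s) \<and> y \<le> 0"
      by blast
  next
    show "continuous_on {a..b} (\<lambda>s. exp (- K s) * u s - G s)"
      by (intro continuous_intros K_cont G_cont u_cont)
  qed
  moreover have "exp (- K b) * norm (c b) \<le> exp (- K b) * u b"
    using c_le_u \<open>a \<le> b\<close> by simp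
  moreover have "exp (- K a) * u a = exp (- K a) * norm (c a)"
    by (simp add: u_def)
  ultimately show ?thesis
    by linarith
qed

section \<open>Fundamental matrices\<close>

lemma at_within_atLeast: "t0 < (s :: real) \<Longrightarrow> at s within {t0..} = at s"
  by (rule at_within_interior) simp

lemma integral_has_real_derivative_atLeast:
  fixes g :: "real \<Rightarrow> real"
  assumes "continuous_on {t0..} g" "t0 \<le> s"
  shows "((\<lambda>t. integral {t0..t} g) has_real_derivative g s) (at s within {t0..})"
proof -
  have "((\<lambda>t. integral {t0..t} g) has_real_derivative g s) (at s within {t0..s + 1})"
    using assms by (intro integral_has_real_derivative) (auto intro: continuous_on_subset)
  moreover have "at s within {t0..} = at s within {t0..s + 1}"
    by (rule at_within_nhd [of _ "{..<s + 1}"]) auto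
  ultimately show ?thesis
    by simp
qed

lemma fundamental_matrix_continuous:
  assumes "fundamental_matrix A t0 W"
  shows "continuous_on {t0..} W" "continuous_on {t0..} (\<lambda>t. matrix_inv (W t))"
    "continuous_on {t0..} (cond_number W)"
proof -
  show W: "continuous_on {t0..} W"
    using assms has_vector_derivative_continuous
    by (fastforce simp: fundamental_matrix_def continuous_on_eq_continuous_within)
  show V: "continuous_on {t0..} (\<lambda>t. matrix_inv (W t))"
    using assms by (intro continuous_on_matrix_inv W) (simp add: fundamental_matrix_def)
  show "continuous_on {t0..} (cond_number W)"
    unfolding cond_number_def [abs_def] by (intro continuous_intros continuous_on_spectral_norm V W)
qed

text \<open>
  The logarithm of the spectral norm is differentiable everywhere, so its derivative \<open>log_growth\<close>
  integrates back to it: the fundamental theorem of calculus for the gauge integral covers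
  derivatives that may be discontinuous.
\<close>
lemma theta_eq_spectral_norm_quotient:
  assumes fund: "fundamental_matrix A t0 W"
    and simple: "\<And>t. t0 \<le> t \<Longrightarrow> simple_singular_value (W t) (sigma_max (W t))"
    and l_cont: "continuous_on {t0..} l"
    and \<tau>: "t0 \<le> \<tau>" "\<tau> \<le> t"
  defines "K \<equiv> \<lambda>t. integral {t0..t} (\<lambda>s. cond_number W s * l s)"
  shows "theta t0 W l t \<tau> = spectral_norm (W t) / spectral_norm (W \<tau>) * exp (K t - K \<tau>)"
proof -
  define P where "P s = ln (spectral_norm (W s)) + K s" for s
  have inv: "invertible (W s)" if "t0 \<le> s" for s
    using fund that by (simp add: fundamental_matrix_def)
  have P': "(P has_vector_derivative log_growth t0 W s + cond_number W s * l s) (at s within {t0..})"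
    if s: "t0 \<le> s" for s
  proof -
    obtain p where "((\<lambda>s. ln (spectral_norm (W s))) has_real_derivative p) (at s within {t0..})"
      by (rule ln_spectral_norm_differentiable [of W "A s ** W s" s "{t0..}"])
        (use fund inv simple s in \<open>auto simp: fundamental_matrix_def\<close>)
    then have "((\<lambda>s. ln (spectral_norm (W s))) has_vector_derivative log_growth t0 W s)
        (at s within {t0..})"
      unfolding log_growth_def vector_derivative_works [symmetric]
      by (auto simp: has_real_derivative_iff_has_vector_derivative intro: differentiableI_vector)
    moreover have "(K has_vector_derivative cond_number W s * l s) (at s within {t0..})"
      unfolding K_def has_real_derivative_iff_has_vector_derivative [symmetric]
      by (intro integral_has_real_derivative_atLeast continuous_intros l_cont s
          fundamental_matrix_continuous [OF fund])
    ultimately show ?thesis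
      unfolding P_def by (rule has_vector_derivative_add)
  qed
  have "((\<lambda>s. log_growth t0 W s + cond_number W s * l s) has_integral P t - P \<tau>) {\<tau>..t}"
    using \<tau> by (intro fundamental_theorem_of_calculus has_vector_derivative_within_subset [OF P'])
      auto
  then have "theta t0 W l t \<tau> = exp (P t - P \<tau>)"
    unfolding theta_def by (simp add: integral_unique)
  also have "\<dots> = exp (ln (spectral_norm (W t))) / exp (ln (spectral_norm (W \<tau>))) * exp (K t - K \<tau>)"
    by (simp add: P_def exp_diff [symmetric] exp_add [symmetric])
  finally show ?thesis
    using \<tau> inv by (simp add: spectral_norm_pos)
qed

lemma has_vector_derivative_within_quotient:
  "(f has_vector_derivative d) (at t within S) \<longleftrightarrow>
    ((\<lambda>s. (f s - f t) /\<^sub>R (s - t)) \<longlongrightarrow> d) (at t within S)"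
proof -
  have "norm ((1 / norm (s - t)) *\<^sub>R (f s - (f t + (s - t) *\<^sub>R d))) = norm ((f s - f t) /\<^sub>R (s - t) - d)"
    if "s \<noteq> t" for s
  proof -
    have "(f s - f t) /\<^sub>R (s - t) - d = (f s - (f t + (s - t) *\<^sub>R d)) /\<^sub>R (s - t)"
      using that by (simp add: scaleR_diff_right scaleR_add_right)
    then show ?thesis
      by (simp add: divide_inverse)
  qed
  then have "((\<lambda>s. norm ((1 / norm (s - t)) *\<^sub>R (f s - (f t + (s - t) *\<^sub>R d)))) \<longlongrightarrow> 0) (at t within S)
      \<longleftrightarrow> ((\<lambda>s. norm ((f s - f t) /\<^sub>R (s - t) - d)) \<longlongrightarrow> 0) (at t within S)"
    by (intro tendsto_cong) (auto simp: eventually_at_filter)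
  then show ?thesis
    by (simp only: has_vector_derivative_def has_derivative_within bounded_linear_scaleR_left
        tendsto_norm_zero_iff Lim_null [of _ d] simp_thms)
qed

text \<open>
  Variation of constants: in the coordinates \<open>W\<^sup>-\<^sup>1 x\<close> the linear part of the equation disappears.
  With \<open>c\<close> the coordinate vector at the base time \<open>t\<close>, the curve \<open>z = x - W c\<close> vanishes at \<open>t\<close> and has
  derivative \<open>b\<close> there. The increment of the coordinates is \<open>W\<^sup>-\<^sup>1 z\<close>, so its difference quotient
  converges by continuity of the inverse.
\<close>
lemma has_vector_derivative_in_moving_frame:
  assumes fund: "fundamental_matrix A t0 W" and "t0 \<le> t"
    and x': "(x has_vector_derivative A t *v x t + b) (at t within {t0..})"
  shows "((\<lambda>s. matrix_inv (W s) *v x s) has_vector_derivative matrix_inv (W t) *v b) (at t within {t0..})"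
proof -
  define V where "V s = matrix_inv (W s)" for s
  define c where "c = V t *v x t"
  define z where "z s = x s - W s *v c" for s
  have WV: "W s ** V s = mat 1" "V s ** W s = mat 1" if "t0 \<le> s" for s
    using fund that by (simp_all add: V_def fundamental_matrix_def matrix_mult_matrix_inv)
  have "W t *v c = x t"
    using WV(1) [OF \<open>t0 \<le> t\<close>] by (simp add: c_def matrix_vector_mul_assoc)
  then have z0: "z t = 0"
    by (simp add: z_def)
  have "((\<lambda>s. W s *v c) has_vector_derivative (A t ** W t) *v c) (at t within {t0..})"
    using fund \<open>t0 \<le> t\<close>
    by (intro bounded_linear.has_vector_derivative
        [OF bounded_bilinear.bounded_linear_left [OF bounded_bilinear_matrix_vector_mult]])
      (simp add: fundamental_matrix_def)
  from has_vector_derivative_diff [OF x' this]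
  have "(z has_vector_derivative b) (at t within {t0..})"
    using \<open>W t *v c = x t\<close> by (simp add: z_def [abs_def] matrix_vector_mul_assoc [symmetric])
  then have "((\<lambda>s. (z s - z t) /\<^sub>R (s - t)) \<longlongrightarrow> b) (at t within {t0..})"
    by (simp add: has_vector_derivative_within_quotient)
  moreover have "(V \<longlongrightarrow> V t) (at t within {t0..})"
    using fundamental_matrix_continuous(2) [OF fund] \<open>t0 \<le> t\<close>
    by (simp add: V_def [abs_def] continuous_on)
  ultimately have lim: "((\<lambda>s. V s *v ((z s - z t) /\<^sub>R (s - t))) \<longlongrightarrow> V t *v b) (at t within {t0..})"
    by (intro bounded_bilinear.tendsto [OF bounded_bilinear_matrix_vector_mult])
  have "V s *v ((z s - z t) /\<^sub>R (s - t)) = (V s *v x s - V t *v x t) /\<^sub>R (s - t)" if "t0 \<le> s" for s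
  proof -
    have "V s *v z s = V s *v x s - c"
      using WV(2) [OF that]
      by (simp add: z_def matrix_vector_mult_diff_distrib matrix_vector_mul_assoc)
    then show ?thesis
      by (simp add: z0 matrix_vector_mult_scaleR c_def)
  qed
  then have "((\<lambda>s. (V s *v x s - V t *v x t) /\<^sub>R (s - t)) \<longlongrightarrow> V t *v b) (at t within {t0..})"
    using lim by (auto elim!: Lim_transform_within [OF _ zero_less_one])
  then show ?thesis
    by (simp add: has_vector_derivative_within_quotient V_def)
qed

section \<open>Boundedness of solutions of the perturbed equation\<close>

text \<open>
  In the coordinates \<open>c = W\<^sup>-\<^sup>1 x\<close> the perturbation gives
  \<open>\<parallel>c'\<parallel> \<le> \<parallel>W\<^sup>-\<^sup>1\<parallel> (l \<parallel>x\<parallel> + F) \<le> \<kappa> l \<parallel>c\<parallel> + \<parallel>W\<^sup>-\<^sup>1\<parallel> F\<close>, where \<open>\<kappa>\<close> is the condition number. Gronwall's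
  inequality, multiplied by \<open>\<parallel>W t\<parallel> exp (K t)\<close>, turns every weight into a value of \<open>theta\<close>, because
  \<open>\<parallel>W t\<parallel> exp (K t - K s) \<parallel>W\<^sup>-\<^sup>1 s\<parallel>\<close> is the condition number at \<open>s\<close> times \<open>theta t s\<close>. The exponential
  bound on \<open>theta\<close> then integrates explicitly.

  The bound on the perturbation is required only strictly before the time \<open>t\<close>, so that the lemma can
  serve as the step of a continuation argument.
\<close>
lemma perturbed_solution_bound:
  fixes W :: "real \<Rightarrow> real ^ 'n ^ 'n"
  assumes fund: "fundamental_matrix A t0 W" and W0: "spectral_norm (W t0) = 1"
    and simple: "\<And>t. t0 \<le> t \<Longrightarrow> simple_singular_value (W t) (sigma_max (W t))"
    and l_cont: "continuous_on {t0..} l" and l_nonneg: "\<And>s. t0 \<le> s \<Longrightarrow> 0 \<le> l s"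
    and theta_le: "\<And>\<tau>. t0 \<le> \<tau> \<Longrightarrow> \<tau> \<le> t \<Longrightarrow> theta t0 W l t \<tau> \<le> D * exp (- \<rho> * (t - \<tau>))"
    and "0 < \<rho>" and k_le: "\<And>s. t0 \<le> s \<Longrightarrow> cond_number W s \<le> k"
    and x': "\<And>s. t0 \<le> s \<Longrightarrow> (x has_vector_derivative A s *v x s + b s) (at s within {t0..})"
    and b_le: "\<And>s. t0 < s \<Longrightarrow> s < t \<Longrightarrow> norm (b s) \<le> l s * norm (x s) + F"
    and "0 \<le> F" "t0 \<le> t"
  shows "norm (x t) \<le> D * k * norm (x t0) * exp (- \<rho> * (t - t0))
    + D * F * k / \<rho> * (1 - exp (- \<rho> * (t - t0)))"
proof -
  define N where "N s = spectral_norm (W s)" for s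
  define V where "V s = matrix_inv (W s)" for s
  define c where "c s = V s *v x s" for s
  define K where "K s = integral {t0..s} (\<lambda>s. cond_number W s * l s)" for s
  define E where "E = N t * exp (K t)"
  \<comment> \<open>The derivative of \<open>G\<close> is the bound on \<open>theta\<close> times \<open>F k / E\<close>.\<close>
  define G where "G s = D * F * k / (\<rho> * E) * exp (- \<rho> * (t - s))" for s
  have cond: "cond_number W s = N s * spectral_norm (V s)" for s
    by (simp add: cond_number_def N_def V_def)
  have cond_nonneg: "0 \<le> cond_number W s" for s
    by (simp add: cond_number_def spectral_norm_nonneg)
  have N_pos: "0 < N s" if "t0 \<le> s" for s
    using fund that by (simp add: N_def fundamental_matrix_def spectral_norm_pos)
  have "0 < E"
    using N_pos \<open>t0 \<le> t\<close> by (simp add: E_def)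
  have theta: "theta t0 W l t s = E * exp (- K s) / N s" if "t0 \<le> s" "s \<le> t" for s
    using theta_eq_spectral_norm_quotient [OF fund simple l_cont that]
    by (simp add: E_def N_def K_def exp_diff exp_minus divide_inverse)
  have cont: "continuous_on {t0..t} h" if "continuous_on {t0..} h" for h :: "real \<Rightarrow> 'z :: topological_space"
    using that by (rule continuous_on_subset) simp
  have c': "(c has_vector_derivative V s *v b s) (at s within {t0..})" if "t0 \<le> s" for s
    unfolding c_def V_def using has_vector_derivative_in_moving_frame [OF fund that x' [OF that]] .
  have K': "(K has_real_derivative cond_number W s * l s) (at s within {t0..})" if "t0 \<le> s" for s
    unfolding K_def
    by (intro integral_has_real_derivative_atLeast continuous_intros l_cont that
        fundamental_matrix_continuous [OF fund])
  have "exp (- K t) * norm (c t) \<le> exp (- K t0) * norm (c t0) + (G t - G t0)"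
  proof (rule gronwall_norm_bound [where \<kappa> = "\<lambda>s. cond_number W s * l s"
        and g = "\<lambda>s. spectral_norm (V s) * F" and c' = "\<lambda>s. V s *v b s"
        and G' = "\<lambda>s. D * F * k / E * exp (- \<rho> * (t - s))"])
    show "continuous_on {t0..t} c"
      using c' has_vector_derivative_continuous
      by (intro cont) (fastforce simp: continuous_on_eq_continuous_within)
    show "continuous_on {t0..t} (\<lambda>s. cond_number W s * l s)"
      by (intro cont continuous_intros l_cont fundamental_matrix_continuous [OF fund])
    show "continuous_on {t0..t} (\<lambda>s. spectral_norm (V s) * F)"
      unfolding V_def
      by (intro cont continuous_intros continuous_on_spectral_norm
          fundamental_matrix_continuous [OF fund])
    show "continuous_on {t0..t} K"
      using K' DERIV_continuous by (intro cont) (fastforce simp: continuous_on_eq_continuous_within)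
    show "continuous_on {t0..t} G"
      unfolding G_def by (intro continuous_intros)
  next
    fix s assume s: "t0 < s" "s < t"
    show "(c has_vector_derivative V s *v b s) (at s)"
      "(K has_real_derivative cond_number W s * l s) (at s)"
      using c' [of s] K' [of s] s by (auto simp: at_within_atLeast)
    show "(G has_real_derivative D * F * k / E * exp (- \<rho> * (t - s))) (at s)"
      unfolding G_def using \<open>0 < \<rho>\<close> \<open>0 < E\<close>
      by (auto intro!: derivative_eq_intros simp: field_simps)
    show "0 \<le> cond_number W s * l s"
      using s by (intro mult_nonneg_nonneg cond_nonneg l_nonneg) auto
    have "W s *v c s = x s"
      using fund s by (simp add: c_def V_def fundamental_matrix_def matrix_vector_mul_assoc
          matrix_mult_matrix_inv)
    then have x_le: "norm (x s) \<le> N s * norm (c s)"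
      using norm_matrix_vector_le_spectral_norm [of "W s" "c s"] by (simp add: N_def)
    have "norm (V s *v b s) \<le> spectral_norm (V s) * norm (b s)"
      by (rule norm_matrix_vector_le_spectral_norm)
    also have "\<dots> \<le> spectral_norm (V s) * (l s * (N s * norm (c s)) + F)"
      using b_le [OF s] mult_left_mono [OF x_le l_nonneg [of s]] s
      by (intro mult_left_mono spectral_norm_nonneg) auto
    finally show "norm (V s *v b s) \<le> cond_number W s * l s * norm (c s) + spectral_norm (V s) * F"
      by (simp add: cond algebra_simps)
    have "exp (- K s) * spectral_norm (V s) = cond_number W s * theta t0 W l t s / E"
      using s N_pos [of s] \<open>0 < E\<close> by (simp add: theta cond)
    also have "\<dots> \<le> k * (D * exp (- \<rho> * (t - s))) / E"
      using s \<open>0 < E\<close> by (intro divide_right_mono mult_mono' k_le theta_le cond_nonneg)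
        (auto simp: theta_def)
    finally have "exp (- K s) * spectral_norm (V s) * F \<le> k * (D * exp (- \<rho> * (t - s))) / E * F"
      using \<open>0 \<le> F\<close> by (rule mult_right_mono)
    then show "exp (- K s) * (spectral_norm (V s) * F) \<le> D * F * k / E * exp (- \<rho> * (t - s))"
      by (simp add: mult_ac)
  qed (use \<open>t0 \<le> t\<close> in auto)
  then have "E * (exp (- K t) * norm (c t)) \<le> E * (norm (c t0) + (G t - G t0))"
    using \<open>0 < E\<close> by (simp add: K_def)
  moreover have "E * (exp (- K t) * norm (c t)) = N t * norm (c t)"
    by (simp add: E_def exp_minus)
  moreover have "E * (G t - G t0) = D * F * k / \<rho> * (1 - exp (- \<rho> * (t - t0)))"
    using \<open>0 < E\<close> \<open>0 < \<rho>\<close> by (simp add: G_def field_simps)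
  ultimately have "N t * norm (c t) \<le> E * norm (c t0) + D * F * k / \<rho> * (1 - exp (- \<rho> * (t - t0)))"
    by (simp add: distrib_left)
  moreover have "norm (x t) \<le> N t * norm (c t)"
  proof -
    have "W t *v c t = x t"
      using fund \<open>t0 \<le> t\<close> by (simp add: c_def V_def fundamental_matrix_def matrix_vector_mul_assoc
          matrix_mult_matrix_inv)
    then show ?thesis
      using norm_matrix_vector_le_spectral_norm [of "W t" "c t"] by (simp add: N_def)
  qed
  moreover have "E * norm (c t0) \<le> (D * exp (- \<rho> * (t - t0))) * (k * norm (x t0))"
  proof (intro mult_mono')
    show "E \<le> D * exp (- \<rho> * (t - t0))"
      using theta [of t0] theta_le [of t0] W0 \<open>t0 \<le> t\<close> by (simp add: N_def K_def)
    have "norm (c t0) \<le> spectral_norm (V t0) * norm (x t0)"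
      unfolding c_def by (rule norm_matrix_vector_le_spectral_norm)
    also have "\<dots> \<le> k * norm (x t0)"
      using k_le [of t0] W0 by (intro mult_right_mono) (auto simp: cond N_def)
    finally show "norm (c t0) \<le> k * norm (x t0)" .
  qed (use \<open>0 < E\<close> in auto)
  ultimately show ?thesis
    by (simp add: mult_ac)
qed

text \<open>
  Continuation: at the first time at which the norm reaches \<open>r\<close>, the step hypothesis applies to the
  past and gives a contradiction.
\<close>
lemma norm_less_by_continuation:
  fixes x :: "real \<Rightarrow> 'a :: real_normed_vector"
  assumes x_cont: "continuous_on {t0..} x"
    and step: "\<And>t. t0 \<le> t \<Longrightarrow> (\<And>s. t0 < s \<Longrightarrow> s < t \<Longrightarrow> norm (x s) < r) \<Longrightarrow> norm (x t) < r"
    and "t0 \<le> t"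
  shows "norm (x t) < r"
proof (rule ccontr)
  assume contra: "\<not> norm (x t) < r"
  let ?B = "{s \<in> {t0..t}. r \<le> norm (x s)}"
  have "continuous_on {t0..t} (\<lambda>s. norm (x s))"
    by (intro continuous_on_norm continuous_on_subset [OF x_cont]) simp
  from continuous_closedin_preimage [OF this, of "{r..}"]
  have "closedin (top_of_set {t0..t}) ({t0..t} \<inter> (\<lambda>s. norm (x s)) -` {r..})"
    by simp
  also have "{t0..t} \<inter> (\<lambda>s. norm (x s)) -` {r..} = ?B"
    by auto
  finally have "compact ?B"
    by (rule closedin_compact [OF compact_Icc])
  moreover have "?B \<noteq> {}"
    using contra \<open>t0 \<le> t\<close> by auto
  ultimately have "\<exists>m\<in>?B. \<forall>s\<in>?B. m \<le> s"
    by (rule compact_attains_inf)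
  then obtain m where m: "m \<in> ?B" "\<And>s. s \<in> ?B \<Longrightarrow> m \<le> s"
    by metis
  have "norm (x m) < r"
  proof (rule step)
    fix s assume s: "t0 < s" "s < m"
    then show "norm (x s) < r"
      using m(1) m(2) [of s] by (cases "r \<le> norm (x s)") auto
  qed (use m(1) in simp)
  then show False
    using m(1) by simp
qed

theorem corollary4:
  fixes A :: "real \<Rightarrow> real ^ 'n ^ 'n"
    and f :: "real \<Rightarrow> real ^ 'n \<Rightarrow> real ^ 'n"
    and \<phi> :: "real \<Rightarrow> real ^ 'n"
    and l :: "real \<Rightarrow> real"
    and W :: "real \<Rightarrow> real \<Rightarrow> real ^ 'n ^ 'n"
    and \<Omega>1 U :: "(real ^ 'n) set"
    and T :: "real set"
    and s0 lhat \<epsilon> D :: real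
  assumes T: "T = {s0..}"
    and A_cont: "continuous_on T A"
    and f_cont: "continuous_on (T \<times> UNIV) (\<lambda>(t, x). f t x)"
    and f_zero: "\<forall>t\<in>T. f t 0 = 0"
    and phi_cont: "continuous_on T \<phi>"
    and phi_norm: "\<forall>t\<in>T. norm (\<phi> t) = 1"
    and l_cont: "continuous_on T l"
    and l_bounds: "\<forall>t\<in>T. 0 < l t \<and> l t \<le> lhat"
    and Omega1: "bounded \<Omega>1" "0 \<in> interior \<Omega>1"
    and U: "0 \<in> interior U"
    and W_fund: "\<forall>t0\<in>T. fundamental_matrix A t0 (W t0) \<and> spectral_norm (W t0 t0) = 1"
    and W_simple: "\<forall>t0\<in>T. \<forall>t\<ge>t0. simple_singular_value (W t0 t) (sigma_max (W t0 t))"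
    and f_bound: "\<forall>t\<in>T. \<forall>x\<in>\<Omega>1. norm (f t x) \<le> l t * norm x"
    and chi_neg: "\<forall>t0\<in>T. chi t0 (W t0) l < 0"
    and eps: "\<epsilon> > 0"
    and D: "D > 0"
    and theta_bound: "\<forall>t0\<in>T. \<forall>\<rho>>0. ereal (- \<rho>) = chi t0 (W t0) l + ereal \<epsilon> \<longrightarrow>
      (\<forall>\<tau>\<ge>t0. \<forall>t\<ge>\<tau>. theta t0 (W t0) l t \<tau> \<le> D * exp (- \<rho> * (t - \<tau>)))"
    and k_bdd: "\<forall>t0\<in>T. bdd_above (cond_number (W t0) ` {t0..})"
  shows "\<forall>t0\<in>T. \<forall>\<rho>>0. ereal (- \<rho>) = chi t0 (W t0) l + ereal \<epsilon> \<longrightarrow>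
    (\<exists>\<delta>>0. \<forall>Fhat x0 x.
      0 \<le> Fhat \<and> Fhat < \<delta> \<and> norm x0 < \<delta> \<and>
      uniquely_solvable A f (\<lambda>t. Fhat *\<^sub>R \<phi> t) t0 U \<and>
      solves_ivp A f (\<lambda>t. Fhat *\<^sub>R \<phi> t) t0 x0 x \<longrightarrow>
        bounded (x ` {t0..}) \<and>
        Limsup at_top (\<lambda>t. ereal (norm (x t)))
          \<le> ereal (D * Fhat * (SUP t\<in>{t0..}. cond_number (W t0) t) / \<rho>))"
proof (intro ballI allI impI)
  fix t0 \<rho> :: real
  assume "t0 \<in> T" "0 < \<rho>" and chi: "ereal (- \<rho>) = chi t0 (W t0) l + ereal \<epsilon>"
  define k where "k = (SUP t\<in>{t0..}. cond_number (W t0) t)"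
  have sub: "s \<in> T" if "t0 \<le> s" for s
    using \<open>t0 \<in> T\<close> that by (simp add: T)
  have k_le: "cond_number (W t0) s \<le> k" if "t0 \<le> s" for s
    unfolding k_def using k_bdd \<open>t0 \<in> T\<close> that by (intro cSUP_upper) auto
  have "0 \<le> cond_number (W t0) t0"
    by (simp add: cond_number_def spectral_norm_nonneg)
  then have k_nonneg: "0 \<le> k"
    using k_le [of t0] by simp
  have l_cont': "continuous_on {t0..} l"
    using l_cont by (rule continuous_on_subset) (use sub in auto)
  obtain r where "0 < r" and ball: "ball 0 r \<subseteq> \<Omega>1"
    using Omega1(2) by (auto simp: mem_interior)
  define C where "C = D * k * (1 + 1 / \<rho>)"
  have "0 \<le> C"
    using D k_nonneg \<open>0 < \<rho>\<close> by (simp add: C_def)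
  \<comment> \<open>With data below \<open>\<delta>\<close> the solution is bounded by \<open>C \<delta>\<close>, and \<open>C \<delta> < (C + 1) \<delta> = r\<close>.\<close>
  define \<delta> where "\<delta> = r / (C + 1)"
  have "0 < \<delta>"
    using \<open>0 < r\<close> \<open>0 \<le> C\<close> by (simp add: \<delta>_def)
  have "C * \<delta> < r"
    using \<open>0 < r\<close> \<open>0 \<le> C\<close> by (simp add: \<delta>_def field_simps)
  have main: "bounded (x ` {t0..}) \<and>
      Limsup at_top (\<lambda>t. ereal (norm (x t))) \<le> ereal (D * F * k / \<rho>)"
    if F: "0 \<le> F" "F < \<delta>" and x0: "norm x0 < \<delta>"
      and ivp: "solves_ivp A f (\<lambda>t. F *\<^sub>R \<phi> t) t0 x0 x" for F x0 x
  proof -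
    define e where "e t = exp (- \<rho> * (t - t0))" for t
    have x': "(x has_vector_derivative A s *v x s + (f s (x s) + F *\<^sub>R \<phi> s)) (at s within {t0..})"
      if "t0 \<le> s" for s
      using ivp that by (simp add: solves_ivp_def add.assoc)
    have x_cont: "continuous_on {t0..} x"
      unfolding continuous_on_eq_continuous_within
      by (blast intro: has_vector_derivative_continuous x')
    have estimate: "norm (x t) \<le> D * k * norm x0 * e t + D * F * k / \<rho> * (1 - e t)"
      if "t0 \<le> t" and small: "\<And>s. t0 < s \<Longrightarrow> s < t \<Longrightarrow> norm (x s) < r" for t
    proof -
      have "norm (f s (x s) + F *\<^sub>R \<phi> s) \<le> l s * norm (x s) + F" if s: "t0 < s" "s < t" for s
      proof -
        have "x s \<in> \<Omega>1"
          using small [OF s] ball by auto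
        then have "norm (f s (x s)) \<le> l s * norm (x s)"
          using f_bound sub [of s] s by simp
        moreover have "norm (F *\<^sub>R \<phi> s) = F"
          using phi_norm sub [of s] s F by simp
        ultimately show ?thesis
          using norm_triangle_ineq [of "f s (x s)" "F *\<^sub>R \<phi> s"] by linarith
      qed
      then have "norm (x t) \<le> D * k * norm (x t0) * e t + D * F * k / \<rho> * (1 - e t)"
        unfolding e_def
      proof (intro perturbed_solution_bound [where W = "W t0" and A = A and l = l
            and b = "\<lambda>s. f s (x s) + F *\<^sub>R \<phi> s"])
        show "fundamental_matrix A t0 (W t0)" "spectral_norm (W t0 t0) = 1"
          using W_fund \<open>t0 \<in> T\<close> by auto
        show "simple_singular_value (W t0 s) (sigma_max (W t0 s))" if "t0 \<le> s" for s
          using W_simple \<open>t0 \<in> T\<close> that by blast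
        show "0 \<le> l s" if "t0 \<le> s" for s
          using l_bounds sub [OF that] by force
        show "theta t0 (W t0) l t \<tau> \<le> D * exp (- \<rho> * (t - \<tau>))" if "t0 \<le> \<tau>" "\<tau> \<le> t" for \<tau>
          using theta_bound \<open>t0 \<in> T\<close> \<open>0 < \<rho>\<close> chi that by blast
      qed (use l_cont' \<open>0 < \<rho>\<close> k_le x' F \<open>t0 \<le> t\<close> in auto)
      then show ?thesis
        using ivp by (simp add: solves_ivp_def)
    qed
    have inside: "norm (x t) < r" if "t0 \<le> t" for t
    proof (rule norm_less_by_continuation [OF x_cont _ that])
      fix t assume "t0 \<le> t" and small: "\<And>s. t0 < s \<Longrightarrow> s < t \<Longrightarrow> norm (x s) < r"
      have e: "0 \<le> e t" "e t \<le> 1"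
        using \<open>0 < \<rho>\<close> \<open>t0 \<le> t\<close> by (auto simp: e_def)
      have "norm (x t) \<le> D * k * norm x0 * e t + D * F * k / \<rho> * (1 - e t)"
        using \<open>t0 \<le> t\<close> small by (rule estimate)
      also have "\<dots> \<le> D * k * norm x0 * 1 + D * F * k / \<rho> * 1"
        using e D k_nonneg F \<open>0 < \<rho>\<close> by (intro add_mono mult_left_mono) auto
      also have "\<dots> = D * k * norm x0 + D * k / \<rho> * F"
        by simp
      also have "\<dots> \<le> D * k * \<delta> + D * k / \<rho> * \<delta>"
        using x0 F D k_nonneg \<open>0 < \<rho>\<close> by (intro add_mono mult_left_mono) auto
      also have "\<dots> = C * \<delta>"
        by (simp add: C_def algebra_simps)
      finally show "norm (x t) < r"
        using \<open>C * \<delta> < r\<close> by linarith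
    qed
    then have "bounded (x ` {t0..})"
      by (intro boundedI [of _ r]) (auto intro: less_imp_le)
    moreover have "Limsup at_top (\<lambda>t. ereal (norm (x t))) \<le> ereal (D * F * k / \<rho>)"
    proof -
      let ?b = "\<lambda>t. D * k * norm x0 * e t + D * F * k / \<rho> * (1 - e t)"
      have "LIM t at_top. - t0 + t :> at_top"
        by (rule filterlim_tendsto_add_at_top [OF tendsto_const filterlim_ident])
      then have "LIM t at_top. - \<rho> * (- t0 + t) :> at_bot"
        using \<open>0 < \<rho>\<close> by (intro filterlim_tendsto_neg_mult_at_bot [OF tendsto_const]) auto
      then have "(e \<longlongrightarrow> 0) at_top"
        using filterlim_compose [OF exp_at_bot] by (simp add: e_def [abs_def])
      then have "(?b \<longlongrightarrow> D * k * norm x0 * 0 + D * F * k / \<rho> * (1 - 0)) at_top"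
        by (intro tendsto_intros)
      then have lim: "((\<lambda>t. ereal (?b t)) \<longlongrightarrow> ereal (D * F * k / \<rho>)) at_top"
        by simp
      have "eventually (\<lambda>t. ereal (norm (x t)) \<le> ereal (?b t)) at_top"
        using eventually_ge_at_top [of t0] by eventually_elim (use estimate inside in simp)
      then have "Limsup at_top (\<lambda>t. ereal (norm (x t))) \<le> Limsup at_top (\<lambda>t. ereal (?b t))"
        by (rule Limsup_mono)
      also have "\<dots> = ereal (D * F * k / \<rho>)"
        by (intro lim_imp_Limsup lim) simp
      finally show ?thesis .
    qed
    ultimately show ?thesis ..
  qed
  show "\<exists>\<delta>>0. \<forall>Fhat x0 x.
      0 \<le> Fhat \<and> Fhat < \<delta> \<and> norm x0 < \<delta> \<and>
      uniquely_solvable A f (\<lambda>t. Fhat *\<^sub>R \<phi> t) t0 U \<and>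
      solves_ivp A f (\<lambda>t. Fhat *\<^sub>R \<phi> t) t0 x0 x \<longrightarrow>
        bounded (x ` {t0..}) \<and>
        Limsup at_top (\<lambda>t. ereal (norm (x t)))
          \<le> ereal (D * Fhat * (SUP t\<in>{t0..}. cond_number (W t0) t) / \<rho>)"
    using \<open>0 < \<delta>\<close> main unfolding k_def by (intro exI [of _ \<delta>]) blast
qed

end
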